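(* Suppose that $D$ is a strictly convex domain of a Banach space $V$, $\kappa\ge 0$, and $(D,d)$ is a $(1,\kappa)$-quasi-geodesic space satisfying Axiom 1' with respect to the norm closure $(\overline{D},\|\cdot\|)$, and such that $$d(sx+(1-s)y,z)\leq \max\{d(x,z),d(y,z)\}\quad\text{for all }x,y,z\in D\text{ and }s\in[0,1].$$ If $f:D\rightarrow D$ is a compact nonexpansive mapping without fixed points, then there exists $\xi\in\partial D$ such that the iterates $f^{n}$ of $f$ converge uniformly on bounded sets of $D$ to $\xi$.
   Context: $\overline{D}$ is the norm closure of $D$, $\partial D=\overline{D}\setminus D$. $D$ is strictly convex if for any distinct $z,w\in\overline{D}$ the open segment $\{sz+(1-s)w:s\in(0,1)\}$ lies in $D$. Axiom 1' with respect to $(\overline{D},\|\cdot\|)$: $(D,d)$ is an open dense subset of the metric space $(\overline{D},\|\cdot\|)$, whose relative topology on $D$ coincides with the topology of $(D,d)$; and for any $w\in D$, if $\{x_n\}$ is a sequence in $D$ converging in norm to some $\xi\in\partial D$, then $d(x_n,w)\to\infty$. A $(1,\kappa)$-quasi-geodesic is a curve $\gamma:[a,b]\to D$ with $|t_1-t_2|-\kappa\le d(\gamma(t_1),\gamma(t_2))\le|t_1-t_2|+\kappa$ for all $t_1,t_2\in[a,b]$; $(D,d)$ is $(1,\kappa)$-quasi-geodesic if every pair of points of $D$ can be connected by a $(1,\kappa)$-quasi-geodesic. $f$ is nonexpansive if $d(f(x),f(y))\le d(x,y)$ for all $x,y\in D$; $f$ is compact if the norm closure of $f(D)$ is compact in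 $(\overline{D},\|\cdot\|)$. Uniform convergence on bounded sets to $\xi$ means: for each $d$-bounded $K\subset D$, $\sup_{y\in K}\|f^n(y)-\xi\|\to 0$. *)

theory Defs
  imports "HOL-Analysis.Analysis"
begin

definition strictly_convex_set :: "'a::real_normed_vector set \<Rightarrow> bool" where
  "strictly_convex_set D \<longleftrightarrow>
     (\<forall>z\<in>closure D. \<forall>w\<in>closure D. z \<noteq> w \<longrightarrow> open_segment z w \<subseteq> D)"

text \<open>Metric spaces are carrier-based: the locale predicate \<open>Metric_space D d\<close> also asks that \<open>d\<close> be nonnegative and symmetric off \<open>D\<close>. This only
  constrains irrelevant values: any metric on \<open>D\<close> extends by \<open>0\<close>.\<close>

text \<open>A curve is a continuous map. Degenerate intervals \<open>a = b\<close> are admitted, since for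
  \<open>\<kappa> = 0\<close> they are the only ones joining a point to itself.\<close>

definition one_quasi_geodesic ::
    "'a set \<Rightarrow> ('a \<Rightarrow> 'a \<Rightarrow> real) \<Rightarrow> real \<Rightarrow> real \<Rightarrow> real \<Rightarrow> (real \<Rightarrow> 'a) \<Rightarrow> bool" where
  "one_quasi_geodesic M d \<kappa> a b \<gamma> \<longleftrightarrow>
     a \<le> b \<and>
     continuous_map (top_of_set {a..b}) (Metric_space.mtopology M d) \<gamma> \<and>
     (\<forall>t1\<in>{a..b}. \<forall>t2\<in>{a..b}.
        \<bar>t1 - t2\<bar> - \<kappa> \<le> d (\<gamma> t1) (\<gamma> t2) \<and> d (\<gamma> t1) (\<gamma> t2) \<le> \<bar>t1 - t2\<bar> + \<kappa>)"

definition one_quasi_geodesic_space :: "'a set \<Rightarrow> ('a \<Rightarrow> 'a \<Rightarrow> real) \<Rightarrow> real \<Rightarrow> bool" where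
  "one_quasi_geodesic_space M d \<kappa> \<longleftrightarrow>
     (\<forall>x\<in>M. \<forall>y\<in>M. \<exists>a b \<gamma>. one_quasi_geodesic M d \<kappa> a b \<gamma> \<and> \<gamma> a = x \<and> \<gamma> b = y)"

definition axiom1' :: "'a::real_normed_vector set \<Rightarrow> ('a \<Rightarrow> 'a \<Rightarrow> real) \<Rightarrow> bool" where
  "axiom1' D d \<longleftrightarrow>
     openin (top_of_set (closure D)) D \<and>
     top_of_set (closure D) closure_of D = closure D \<and>
     Metric_space.mtopology D d = top_of_set D \<and>
     (\<forall>w\<in>D. \<forall>x \<xi>. range x \<subseteq> D \<and> \<xi> \<in> closure D - D \<and> x \<longlonglongrightarrow> \<xi> \<longrightarrow>
        filterlim (\<lambda>n::nat. d (x n) w) at_top sequentially)"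

definition nonexpansive_on :: "'a set \<Rightarrow> ('a \<Rightarrow> 'a \<Rightarrow> real) \<Rightarrow> ('a \<Rightarrow> 'a) \<Rightarrow> bool" where
  "nonexpansive_on D d f \<longleftrightarrow> (\<forall>x\<in>D. \<forall>y\<in>D. d (f x) (f y) \<le> d x y)"

text \<open>For a self-map of \<open>D\<close>, closure and compactness in the closed set \<open>closure D\<close> agree with
  closure and compactness in the ambient space.\<close>

definition compact_mapping_on :: "'a::real_normed_vector set \<Rightarrow> ('a \<Rightarrow> 'a) \<Rightarrow> bool" where
  "compact_mapping_on D f \<longleftrightarrow> compact (closure (f ` D))"

definition converges_uniformly_on_bounded ::
    "'a::real_normed_vector set \<Rightarrow> ('a \<Rightarrow> 'a \<Rightarrow> real) \<Rightarrow> (nat \<Rightarrow> 'a \<Rightarrow> 'a) \<Rightarrow> 'a \<Rightarrow> bool" where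
  "converges_uniformly_on_bounded D d g \<xi> \<longleftrightarrow>
     (\<forall>K. Metric_space.mbounded D d K \<longrightarrow> uniform_limit K g (\<lambda>_. \<xi>) sequentially)"

end

theory Submission
  imports Defs
begin

text \<open>The argument has two halves: the orbits of \<open>f\<close> run off to infinity, and, if they do, they all have
to leave \<open>D\<close> at one and the same boundary point.

\<^emph>\<open>Divergence.\<close> The sequence condition at the boundary says that norm limits of \<open>d\<close>-bounded sequences
stay in \<open>D\<close>; as \<open>f\<close> is compact, every \<open>d\<close>-bounded sequence in \<open>f ` D\<close> therefore has a subsequence
converging in \<open>(D, d)\<close>. So \<open>f\<close> behaves like a nonexpansive map of a proper space, and Calka's theorem
applies (\<open>calka\<close>): if one orbit fails to tend to infinity, then some orbit is bounded. Around a
bounded orbit, the set of points whose asymptotic distance to it is at most the bound is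
invariant and closed; it is convex because balls are. Schauder's theorem then yields a fixed point
(\<open>bounded_orbit_imp_fixed_point\<close>). Schauder is obtained from a Brouwer theorem for cubes
\<open>[0,1]\<^sup>n\<close> in which \<open>n\<close> is a number rather than a type, since the dimension depends on the precision
of the approximation.

\<^emph>\<open>A single boundary point.\<close> Let \<open>u\<^sub>n \<rightarrow> \<xi>\<close> and \<open>v\<^sub>n \<rightarrow> \<eta>\<close> in norm, with \<open>\<xi> \<noteq> \<eta>\<close>. By strict
convexity the midpoints of \<open>u\<^sub>n\<close> and \<open>v\<^sub>n\<close> converge to a point of \<open>D\<close>, and by convexity of balls they
are no farther from \<open>u\<^sub>n\<close> than \<open>v\<^sub>n\<close> is. Hence \<open>d u\<^sub>n v\<^sub>n \<ge> d u\<^sub>n w - C\<close>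
(\<open>distance_to_other_limit\<close>). By symmetry, \<open>d u\<^sub>n v\<^sub>n\<close> is thus at least the maximum of the
two distances to \<open>w\<close>, up to a constant. Quasi-geodesics improve the maximum to the sum: such a curve from
\<open>u\<^sub>n\<close> to \<open>v\<^sub>n\<close> contains a point \<open>z\<^sub>n\<close> that is at a fixed norm distance from \<open>\<xi>\<close>, and the
estimate can be applied to both pairs \<open>(u\<^sub>n, z\<^sub>n)\<close> and \<open>(v\<^sub>n, z\<^sub>n)\<close>, once \<open>z\<^sub>n\<close> has a norm
limit. In infinite dimensions it need not have one; the remedy is to take the image under \<open>f\<close> of a
quasi-geodesic between preimages, which lies in a relatively compact set (\<open>no_two_limits\<close>).

Finally let \<open>a n = d ((f ^^ n) x) x\<close>, and let \<open>n\<close> be a record time of \<open>a\<close>, meaning \<open>a m \<le> a n\<close> for all \<open>m \<le> n\<close>.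
Then \<open>d ((f ^^ n) x) ((f ^^ k) x) \<le> a (n - k) \<le> a n\<close> for \<open>k \<le> n\<close>, which falls short of the sum \<open>a n + a k\<close> by at
least \<open>a k\<close>, and \<open>a k\<close> tends to infinity. So no subsequence of the orbit can converge to a point other than the limit \<open>\<xi>\<close> along
record times. Uniformity on bounded sets follows from \<open>distance_to_other_limit\<close>, as sequences at bounded
\<open>d\<close>-distance that tend to infinity have the same limit.\<close>

section \<open>Brouwer's theorem for cubes of varying dimension\<close>

definition nat_cube :: "nat \<Rightarrow> (nat \<Rightarrow> real) set" where
  "nat_cube n = {t. (\<forall>i<n. 0 \<le> t i \<and> t i \<le> 1) \<and> (\<forall>i\<ge>n. t i = 0)}"

lemma compact_nat_cube: "compact (nat_cube n)"
proof -
  have "nat_cube n = PiE UNIV (\<lambda>i. if i < n then {0..1} else {0})"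
  proof (rule set_eqI)
    fix t :: "nat \<Rightarrow> real"
    have "t \<in> PiE UNIV (\<lambda>i. if i < n then {0..1} else {0}) \<longleftrightarrow>
        (\<forall>i. if i < n then 0 \<le> t i \<and> t i \<le> 1 else t i = 0)"
      by (simp add: PiE_iff if_distrib[of "(\<in>) _"])
    then show "t \<in> nat_cube n \<longleftrightarrow> t \<in> PiE UNIV (\<lambda>i. if i < n then {0..1} else {0})"
      by (simp add: nat_cube_def) (metis not_less)
  qed
  moreover have "compactin (product_topology (\<lambda>_. euclidean) UNIV)
      (PiE UNIV (\<lambda>i. if i < n then {0..1::real} else {0}))"
    by (simp add: compactin_PiE)
  ultimately show ?thesis
    by (simp add: euclidean_product_topology)
qed

lemma tendsto_fun_iff:
  fixes X :: "'b \<Rightarrow> 'c \<Rightarrow> 'd::topological_space"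
  shows "(X \<longlongrightarrow> l) F \<longleftrightarrow> (\<forall>i. ((\<lambda>k. X k i) \<longlongrightarrow> l i) F)"
  using limitin_componentwise[of "\<lambda>_. euclidean" UNIV X l F]
  by (simp add: euclidean_product_topology)

text \<open>Kuhn's combinatorial lemma is applied to ever finer grids. A vertex is labelled \<open>0\<close> in direction \<open>i\<close>
only if \<open>G\<close> does not decrease its \<open>i\<close>-th coordinate, and \<open>1\<close> only if \<open>G\<close> does not increase it. Every grid contains a small cube with both
labels in every direction, and at a limit point \<open>t\<close> of these cubes continuity gives both
\<open>t i \<le> G t i\<close> and \<open>G t i \<le> t i\<close>.\<close>

lemma brouwer_nat_cube:
  assumes cont: "\<And>i. i < n \<Longrightarrow> continuous_on (nat_cube n) (\<lambda>t. G t i)"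
    and range: "\<And>t i. \<lbrakk>t \<in> nat_cube n; i < n\<rbrakk> \<Longrightarrow> 0 \<le> G t i \<and> G t i \<le> (1::real)"
  obtains t where "t \<in> nat_cube n" "\<And>i. i < n \<Longrightarrow> G t i = t i"
proof -
  define grid where "grid p x = (\<lambda>i. if i < n then real (x i) / real (Suc p) else 0)"
    for p and x :: "nat \<Rightarrow> nat"
  have grid_in: "grid p x \<in> nat_cube n" if x: "\<And>i. i < n \<Longrightarrow> x i \<le> Suc p" for p x
  proof -
    have "real (x i) / real (Suc p) \<le> 1" if "i < n" for i
      using x[OF that] by (simp add: divide_le_eq_1)
    then show ?thesis
      by (simp add: nat_cube_def grid_def)
  qed
  define corner where "corner q x \<longleftrightarrow> (\<forall>j<n. q j \<le> x j \<and> x j \<le> q j + 1)"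
    for q x :: "nat \<Rightarrow> nat"
  have "\<exists>q. (\<forall>i<n. q i < Suc p) \<and> (\<forall>i<n.
      (\<exists>r. corner q r \<and> grid p r i \<le> G (grid p r) i) \<and>
      (\<exists>s. corner q s \<and> G (grid p s) i \<le> grid p s i))" for p
  proof -
    \<comment> \<open>Vertices on the faces get the label that Kuhn's lemma prescribes; it is
      admissible there, because \<open>G\<close> maps into the cube.\<close>
    define label where "label x i =
      (if x i = 0 \<or> x i \<noteq> Suc p \<and> grid p x i \<le> G (grid p x) i then 0 else 1::nat)" for x i
    have lab0: "grid p x i \<le> G (grid p x) i"
      if x: "\<forall>j<n. x j \<le> Suc p" and i: "i < n" and lab: "label x i = 0" for x i
    proof (cases "x i = 0")
      case True
      then have "grid p x i = 0"
        using i by (simp add: grid_def)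
      then show ?thesis
        using range[OF grid_in i, of x p] x by simp
    next
      case False
      then show ?thesis
        using lab by (simp add: label_def split: if_splits)
    qed
    have lab1: "G (grid p x) i \<le> grid p x i"
      if x: "\<forall>j<n. x j \<le> Suc p" and i: "i < n" and lab: "label x i \<noteq> 0" for x i
    proof (cases "x i = Suc p")
      case True
      then have "grid p x i = 1"
        using i by (simp add: grid_def)
      then show ?thesis
        using range[OF grid_in i, of x p] x by simp
    next
      case False
      then show ?thesis
        using lab by (simp add: label_def split: if_splits)
    qed
    have l: "\<forall>x. (\<forall>i<n. x i \<le> Suc p) \<longrightarrow> (\<forall>i<n. label x i = 0 \<or> label x i = 1)"
      "\<forall>x. (\<forall>i<n. x i \<le> Suc p) \<longrightarrow> (\<forall>i<n. x i = 0 \<longrightarrow> label x i = 0)"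
      "\<forall>x. (\<forall>i<n. x i \<le> Suc p) \<longrightarrow> (\<forall>i<n. x i = Suc p \<longrightarrow> label x i = 1)"
      by (simp_all add: label_def)
    obtain q where q: "\<forall>i<n. q i < Suc p"
      and rs: "\<forall>i<n. \<exists>r s. corner q r \<and> corner q s \<and> label r i \<noteq> label s i"
      using kuhn_lemma[OF zero_less_Suc l] unfolding corner_def by metis
    have "(\<exists>r. corner q r \<and> grid p r i \<le> G (grid p r) i) \<and>
      (\<exists>s. corner q s \<and> G (grid p s) i \<le> grid p s i)" if i: "i < n" for i
    proof -
      have "\<exists>r s. corner q r \<and> corner q s \<and> label r i \<noteq> label s i"
        using rs i by simp
      then obtain r s where rs: "corner q r" "corner q s" and ne: "label r i \<noteq> label s i"
        by (elim exE conjE)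
      have le: "\<forall>j<n. x j \<le> Suc p" if "corner q x" for x
      proof (intro allI impI)
        fix j assume "j < n"
        then have "x j \<le> q j + 1" "q j < Suc p"
          using q that by (auto simp: corner_def)
        then show "x j \<le> Suc p" by linarith
      qed
      consider "label r i = 0" "label s i \<noteq> 0" | "label s i = 0" "label r i \<noteq> 0"
        using ne by (auto simp: label_def split: if_splits)
      then show ?thesis
      proof cases
        case 1
        then show ?thesis
          using rs lab0[OF le i, of r] lab1[OF le i, of s] by blast
      next
        case 2
        then show ?thesis
          using rs lab0[OF le i, of s] lab1[OF le i, of r] by blast
      qed
    qed
    with q show ?thesis by blast
  qed
  then obtain q where q: "\<And>p i. i < n \<Longrightarrow> q p i < Suc p"
    and rs: "\<And>p i. i < n \<Longrightarrow> \<exists>r. corner (q p) r \<and> grid p r i \<le> G (grid p r) i"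
      "\<And>p i. i < n \<Longrightarrow> \<exists>s. corner (q p) s \<and> G (grid p s) i \<le> grid p s i"
    by metis
  have "grid p (q p) \<in> nat_cube n" for p
    using q by (intro grid_in) (simp add: less_imp_le)
  then obtain t \<rho> where t: "t \<in> nat_cube n" and \<rho>: "strict_mono (\<rho> :: nat \<Rightarrow> nat)"
    and lim: "((\<lambda>p. grid p (q p)) \<circ> \<rho>) \<longlonglongrightarrow> t"
    using compact_imp_seq_compact[OF compact_nat_cube] unfolding seq_compact_def by metis
  \<comment> \<open>Both neighbours of a grid point tend to the limit of the grid points.\<close>
  have near: "(\<lambda>k. grid (\<rho> k) (y (\<rho> k))) \<longlonglongrightarrow> t"
    if y: "\<And>p. corner (q p) (y p)" for y
  proof -
    have "(\<lambda>k. grid (\<rho> k) (y (\<rho> k)) j) \<longlonglongrightarrow> t j" for j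
    proof (cases "j < n")
      case True
      have 1: "(\<lambda>k. grid (\<rho> k) (q (\<rho> k)) j) \<longlonglongrightarrow> t j"
        using lim by (simp add: o_def tendsto_fun_iff)
      have 2: "(\<lambda>k. 1 / real (Suc (\<rho> k))) \<longlonglongrightarrow> 0"
        using LIMSEQ_subseq_LIMSEQ[OF LIMSEQ_inverse_real_of_nat \<rho>] by (simp add: o_def inverse_eq_divide)
      have 3: "(\<lambda>k. grid (\<rho> k) (q (\<rho> k)) j + 1 / real (Suc (\<rho> k))) \<longlonglongrightarrow> t j"
        using tendsto_add[OF 1 2] by simp
      show ?thesis
      proof (rule tendsto_sandwich[OF _ _ 1 3]; intro always_eventually allI)
        fix k
        have "q (\<rho> k) j \<le> y (\<rho> k) j" "y (\<rho> k) j \<le> q (\<rho> k) j + 1"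
          using y[of "\<rho> k"] True by (simp_all add: corner_def)
        then have a: "real (q (\<rho> k) j) \<le> real (y (\<rho> k) j)" "real (y (\<rho> k) j) \<le> real (q (\<rho> k) j) + 1"
          by linarith+
        show "grid (\<rho> k) (q (\<rho> k)) j \<le> grid (\<rho> k) (y (\<rho> k)) j"
          using a True by (simp add: grid_def divide_right_mono)
        show "grid (\<rho> k) (y (\<rho> k)) j \<le> grid (\<rho> k) (q (\<rho> k)) j + 1 / real (Suc (\<rho> k))"
          using a True by (simp add: grid_def divide_right_mono flip: add_divide_distrib)
      qed
    next
      case False
      then show ?thesis
        using t by (simp add: grid_def nat_cube_def)
    qed
    then show ?thesis
      by (simp add: tendsto_fun_iff)
  qed
  have "G t i = t i" if i: "i < n" for i
  proof (rule antisym)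
    have lims: "(\<lambda>k. grid (\<rho> k) (y (\<rho> k)) i) \<longlonglongrightarrow> t i"
      "(\<lambda>k. G (grid (\<rho> k) (y (\<rho> k))) i) \<longlonglongrightarrow> G t i"
      if y: "\<And>p. corner (q p) (y p)" for y
    proof -
      show "(\<lambda>k. grid (\<rho> k) (y (\<rho> k)) i) \<longlonglongrightarrow> t i"
        using near[of y, OF y] by (simp add: tendsto_fun_iff)
      have "y p j \<le> Suc p" if "j < n" for p j
        using y[of p, unfolded corner_def, rule_format, OF that] q[OF that, of p] by linarith
      then have "\<forall>k. grid (\<rho> k) (y (\<rho> k)) \<in> nat_cube n"
        by (intro allI grid_in)
      then show "(\<lambda>k. G (grid (\<rho> k) (y (\<rho> k))) i) \<longlonglongrightarrow> G t i"
        by (intro continuous_on_tendsto_compose[OF cont[OF i] near[of y, OF y] t] always_eventually)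
    qed
    obtain r where r: "\<And>p. corner (q p) (r p)" "\<And>p. grid p (r p) i \<le> G (grid p (r p)) i"
      using rs(1)[OF i] by metis
    obtain s where s: "\<And>p. corner (q p) (s p)" "\<And>p. G (grid p (s p)) i \<le> grid p (s p) i"
      using rs(2)[OF i] by metis
    show "G t i \<le> t i"
      using LIMSEQ_le[OF lims(2,1)[of s]] s by auto
    show "t i \<le> G t i"
      using LIMSEQ_le[OF lims(1,2)[of r]] r by auto
  qed
  with t show thesis by (rule that)
qed

section \<open>Schauder's theorem\<close>

text \<open>Points of \<open>Y\<close> are replaced by convex combinations of a finite \<open>\<epsilon>\<close>-net, the weights being
\<open>\<phi> i y = max 0 (\<epsilon> - dist y (p i))\<close> after normalisation. This turns \<open>g\<close> into a self-map of a
cube, whose fixed point is the vector of weights of an almost fixed point of \<open>g\<close>. Only convex combinations of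
finitely many points of \<open>Y\<close> occur, so \<open>C\<close> can be any convex set that contains \<open>Y\<close>, closed or not.\<close>

lemma schauder_approximation:
  fixes g :: "'a::real_normed_vector \<Rightarrow> 'a"
  assumes "convex C" "C \<noteq> {}" "continuous_on C g" "g ` C \<subseteq> Y" "compact Y" "Y \<subseteq> C" "\<epsilon> > 0"
  obtains x where "x \<in> C" "dist x (g x) \<le> \<epsilon>"
proof -
  obtain K where K: "finite K" "K \<subseteq> Y" "Y \<subseteq> (\<Union>x\<in>K. ball x \<epsilon>)"
    by (rule compactE_image[OF \<open>compact Y\<close>, of Y "\<lambda>x. ball x \<epsilon>"]) (use \<open>\<epsilon> > 0\<close> in auto)
  define n where "n = card K"
  obtain p where p: "bij_betw p {..<n} K"
    using ex_bij_betw_nat_finite[OF K(1)] by (auto simp: n_def atLeast0LessThan)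
  have pY: "p i \<in> Y" if "i < n" for i
    using p K(2) that by (auto simp: bij_betw_def)
  have "K \<noteq> {}"
    using K(3) assms by auto
  then have n: "n > 0"
    using K(1) by (simp add: n_def card_gt_0_iff)

  define \<phi> where "\<phi> i y = max 0 (\<epsilon> - dist y (p i))" for i y
  define \<Phi> where "\<Phi> y = (\<Sum>i<n. \<phi> i y)" for y
  have \<phi>_nonneg: "0 \<le> \<phi> i y" for i y
    by (simp add: \<phi>_def)
  have \<Phi>_pos: "0 < \<Phi> y" if y: "y \<in> Y" for y
  proof -
    obtain c where c: "c \<in> K" "dist c y < \<epsilon>"
      using K(3) y by auto
    then obtain i where "i < n" "c = p i"
      using p by (auto simp: bij_betw_def)
    with c have i: "i < n" "dist y (p i) < \<epsilon>"
      by (simp_all add: dist_commute)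
    have "0 < \<phi> i y"
      using i by (simp add: \<phi>_def)
    also have "\<dots> \<le> \<Phi> y"
      unfolding \<Phi>_def using i by (intro member_le_sum) (auto simp: \<phi>_nonneg)
    finally show ?thesis .
  qed
  have \<phi>_le: "\<phi> i y \<le> \<Phi> y" if "i < n" for i y
    unfolding \<Phi>_def using that by (intro member_le_sum) (auto simp: \<phi>_nonneg)

  \<comment> \<open>A retraction of the cube onto the standard simplex, so that the cube parametrises
    the convex hull of the net.\<close>
  define T where "T t = (\<Sum>i<n. t i)" for t :: "nat \<Rightarrow> real"
  define w where "w t i = (t i + max 0 (1 - T t) / n) / max 1 (T t)" for t i
  define x where "x t = (\<Sum>i<n. w t i *\<^sub>R p i)" for t
  have w_nonneg: "0 \<le> w t i" if "t \<in> nat_cube n" "i < n" for t i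
    using that by (auto simp: w_def nat_cube_def)
  have w_sum: "(\<Sum>i<n. w t i) = 1" for t
  proof -
    have "(\<Sum>i<n. w t i) = (T t + max 0 (1 - T t)) / max 1 (T t)"
      using n by (simp add: w_def T_def sum.distrib flip: sum_divide_distrib)
    also have "\<dots> = 1"
      by (simp add: max_def)
    finally show ?thesis .
  qed
  have xC: "x t \<in> C" if "t \<in> nat_cube n" for t
    unfolding x_def
    using that \<open>convex C\<close> w_sum w_nonneg pY \<open>Y \<subseteq> C\<close> by (intro convex_sum) auto
  then have gxY: "g (x t) \<in> Y" if "t \<in> nat_cube n" for t
    using that assms by blast

  have cont_t: "continuous_on S (\<lambda>t. t i)" for S and i :: nat
    by (rule continuous_on_subset[OF continuous_on_product_coordinates]) simp
  have cont_T: "continuous_on S T" for S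
    unfolding T_def by (intro continuous_intros cont_t)
  have "continuous_on S x" for S
    unfolding x_def w_def by (intro continuous_intros cont_t cont_T) (auto simp: max_def)
  then have cont_gx: "continuous_on (nat_cube n) (\<lambda>t. g (x t))"
    by (rule continuous_on_compose2[OF assms(3)]) (use xC in auto)
  have cont_\<phi>: "continuous_on (nat_cube n) (\<lambda>t. \<phi> i (g (x t)))" for i
    unfolding \<phi>_def by (intro continuous_intros cont_gx)

  define G where "G t i = \<phi> i (g (x t)) / \<Phi> (g (x t))" for t i
  have G_cont: "continuous_on (nat_cube n) (\<lambda>t. G t i)" for i
    unfolding G_def \<Phi>_def
    by (intro continuous_intros cont_\<phi>) (use gxY \<Phi>_pos in \<open>force simp: \<Phi>_def\<close>)
  have G_range: "0 \<le> G t i \<and> G t i \<le> 1" if "t \<in> nat_cube n" "i < n" for t i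
    using \<Phi>_pos[OF gxY[OF that(1)]] \<phi>_le[OF that(2)] \<phi>_nonneg by (simp add: G_def divide_le_eq_1)
  obtain t where t: "t \<in> nat_cube n" and fix_t: "\<And>i. i < n \<Longrightarrow> G t i = t i"
    using brouwer_nat_cube[of n G, OF G_cont G_range] by blast
  let ?y = "g (x t)"
  have pos: "0 < \<Phi> ?y"
    using \<Phi>_pos gxY t by blast
  have "T t = (\<Sum>i<n. \<phi> i ?y / \<Phi> ?y)"
    unfolding T_def using fix_t by (simp add: G_def)
  also have "\<dots> = 1"
    using pos by (simp add: \<Phi>_def flip: sum_divide_distrib)
  finally have Tt: "T t = 1" .
  \<comment> \<open>Only net points within \<open>\<epsilon>\<close> of \<open>?y\<close> carry weight.\<close>
  have "x t - ?y = (\<Sum>i<n. t i *\<^sub>R p i) - (\<Sum>i<n. t i) *\<^sub>R ?y"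
    using Tt by (simp add: x_def w_def) (simp add: T_def)
  also have "\<dots> = (\<Sum>i<n. t i *\<^sub>R (p i - ?y))"
    by (simp add: scaleR_sum_left scaleR_right_diff_distrib sum_subtractf)
  finally have "norm (x t - ?y) \<le> (\<Sum>i<n. norm (t i *\<^sub>R (p i - ?y)))"
    by (simp only: norm_sum)
  also have "\<dots> \<le> (\<Sum>i<n. t i * \<epsilon>)"
  proof (rule sum_mono)
    fix i assume "i \<in> {..<n}"
    then have i: "i < n" by simp
    have t0: "0 \<le> t i"
      using t i by (simp add: nat_cube_def)
    show "norm (t i *\<^sub>R (p i - ?y)) \<le> t i * \<epsilon>"
    proof (cases "t i = 0")
      case False
      then have "\<phi> i ?y \<noteq> 0"
        using fix_t[OF i] by (auto simp: G_def)
      then have "dist ?y (p i) < \<epsilon>"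
        by (auto simp: \<phi>_def max_def split: if_splits)
      then show ?thesis
        using t0 by (simp add: dist_norm norm_minus_commute mult_left_mono)
    qed simp
  qed
  also have "\<dots> = \<epsilon>"
    using Tt by (simp add: T_def flip: sum_distrib_right)
  finally show thesis
    using that[of "x t"] xC t by (simp add: dist_norm)
qed

theorem schauder_fixed_point:
  fixes g :: "'a::real_normed_vector \<Rightarrow> 'a"
  assumes "convex C" "C \<noteq> {}" "continuous_on C g" "g ` C \<subseteq> Y" "compact Y" "Y \<subseteq> C"
  obtains x where "x \<in> C" "g x = x"
proof -
  have "\<exists>x. x \<in> C \<and> dist x (g x) \<le> 1 / real (Suc k)" for k
    using schauder_approximation[OF assms, of "1 / real (Suc k)"] by auto
  then obtain x where x: "\<And>k. x k \<in> C" and small: "\<And>k. dist (x k) (g (x k)) \<le> 1 / real (Suc k)"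
    by metis
  have gx: "\<forall>k. g (x k) \<in> Y"
    using x assms by blast
  obtain y r where y: "y \<in> Y" and r: "strict_mono r" and lim: "(\<lambda>k. g (x (r k))) \<longlonglongrightarrow> y"
    using seq_compactE[OF compact_imp_seq_compact[OF \<open>compact Y\<close>] gx] by (auto simp: o_def)
  have inv: "(\<lambda>k. 1 / real (Suc k)) \<longlonglongrightarrow> 0"
    using LIMSEQ_inverse_real_of_nat by (simp add: inverse_eq_divide)
  have "(\<lambda>k. dist (x k) (g (x k))) \<longlonglongrightarrow> 0"
    by (rule tendsto_sandwich[OF _ _ tendsto_const inv]) (use small in auto)
  from LIMSEQ_subseq_LIMSEQ[OF this r] have "(\<lambda>k. x (r k) - g (x (r k))) \<longlonglongrightarrow> 0"
    by (simp add: dist_norm o_def tendsto_norm_zero_iff)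
  from tendsto_add[OF this lim] have xr: "(\<lambda>k. x (r k)) \<longlonglongrightarrow> y"
    by simp
  have "y \<in> C"
    using y assms by blast
  have "(\<lambda>k. g (x (r k))) \<longlonglongrightarrow> g y"
    by (rule continuous_on_tendsto_compose[OF assms(3) xr \<open>y \<in> C\<close>]) (use x in auto)
  then have "g y = y"
    using lim LIMSEQ_unique by blast
  with \<open>y \<in> C\<close> show thesis by (rule that)
qed

section \<open>Calka's theorem\<close>

text \<open>In a proper space the last condition holds for every map; the theorem of Calka only ever extracts subsequences from
orbits, so it is enough to ask for it on the image of the map.\<close>

locale proper_nonexpansive_map = Metric_space M d for M :: "'a set" and d +
  fixes f :: "'a \<Rightarrow> 'a"
  assumes maps: "x \<in> M \<Longrightarrow> f x \<in> M"
    and nonexpansive: "\<lbrakk>x \<in> M; y \<in> M\<rbrakk> \<Longrightarrow> d (f x) (f y) \<le> d x y"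
    and bounded_image_convergent_subseq:
      "\<And>s w R. \<lbrakk>\<And>n::nat. s n \<in> f ` M; w \<in> M; \<And>n. d (s n) w \<le> R\<rbrakk> \<Longrightarrow>
        \<exists>l\<in>M. \<exists>r. strict_mono r \<and> (\<lambda>n. d (s (r n)) l) \<longlonglongrightarrow> 0"
begin

lemma iterate_in: "x \<in> M \<Longrightarrow> (f ^^ n) x \<in> M"
  by (induction n) (auto intro: maps)

lemma iterate_in_image: "\<lbrakk>x \<in> M; 0 < n\<rbrakk> \<Longrightarrow> (f ^^ n) x \<in> f ` M"
  by (cases n) (auto intro: iterate_in)

lemma iterate_nonexpansive: "\<lbrakk>x \<in> M; y \<in> M\<rbrakk> \<Longrightarrow> d ((f ^^ n) x) ((f ^^ n) y) \<le> d x y"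
proof (induction n)
  case (Suc n)
  then show ?case
    using nonexpansive[OF iterate_in[of x n] iterate_in[of y n]] by simp
qed simp

lemma iterate_nonexpansive_add:
  "\<lbrakk>x \<in> M; y \<in> M\<rbrakk> \<Longrightarrow> d ((f ^^ (m + n)) x) ((f ^^ (m + k)) y) \<le> d ((f ^^ n) x) ((f ^^ k) y)"
  using iterate_nonexpansive[OF iterate_in[of x n] iterate_in[of y k], of m]
  by (simp add: funpow_add)

text \<open>The point \<open>y\<close> is a limit of the orbit of \<open>x\<close> along times \<open>p k\<close>. For large \<open>k < j\<close>, iterating \<open>f\<close>
another \<open>p j - p k\<close> times takes \<open>(f ^^ p k) x\<close>, a point close to \<open>y\<close>, to another point close to \<open>y\<close>; being
nonexpansive, the same iterate takes \<open>y\<close> to a point close to \<open>y\<close>.\<close>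

lemma recurrent_point:
  assumes x: "x \<in> M" and w: "w \<in> M" and nd: "\<not> filterlim (\<lambda>n. d ((f ^^ n) x) w) at_top sequentially"
  obtains y where "y \<in> M" "\<And>N \<epsilon>. \<epsilon> > 0 \<Longrightarrow> \<exists>m\<ge>N. d ((f ^^ m) y) y < \<epsilon>"
proof -
  obtain R where "\<not> (\<forall>\<^sub>F n in sequentially. R \<le> d ((f ^^ n) x) w)"
    using nd by (auto simp: filterlim_at_top)
  then obtain r where r: "strict_mono (r :: nat \<Rightarrow> nat)" and R: "\<And>k. d ((f ^^ r k) x) w < R"
    using not_eventually_sequentiallyD by (metis not_le)
  have pos: "0 < r (Suc k)" for k
    using strict_monoD[OF r, of k "Suc k"] by simp
  obtain y q where y: "y \<in> M" and q: "strict_mono (q :: nat \<Rightarrow> nat)"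
    and lim: "(\<lambda>k. d ((f ^^ r (Suc (q k))) x) y) \<longlonglongrightarrow> 0"
    using bounded_image_convergent_subseq[of "\<lambda>k. (f ^^ r (Suc k)) x" w R]
      iterate_in_image[OF x pos] w R by (meson less_imp_le)
  define p where "p k = r (Suc (q k))" for k
  have p: "strict_mono p"
    using r q by (simp add: p_def strict_mono_def)
  have "\<exists>m\<ge>N. d ((f ^^ m) y) y < \<epsilon>" if "\<epsilon> > 0" for N \<epsilon>
  proof -
    obtain k where k: "\<And>j. j \<ge> k \<Longrightarrow> d ((f ^^ p j) x) y < \<epsilon> / 2"
      using lim \<open>\<epsilon> > 0\<close> unfolding p_def lim_sequentially dist_real_def
      by (metis (no_types, lifting) abs_of_nonneg diff_zero half_gt_zero nonneg)
    \<comment> \<open>The index is chosen so large that \<open>p ?j \<ge> p k + N\<close>.\<close>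
    let ?j = "p k + N + k"
    have j: "p k + N \<le> p ?j"
      using seq_suble[OF p, of ?j] by linarith
    define e where "e = p ?j - p k"
    have e: "p ?j = e + p k" "e \<ge> N"
      using j by (simp_all add: e_def)
    have "d ((f ^^ e) y) y \<le> d ((f ^^ e) y) ((f ^^ (e + p k)) x) + d ((f ^^ (e + p k)) x) y"
      by (intro triangle iterate_in x y)
    also have "d ((f ^^ e) y) ((f ^^ (e + p k)) x) \<le> d ((f ^^ p k) x) y"
      using iterate_nonexpansive_add[OF y x, of e 0 "p k"] by (simp add: commute)
    also have "\<dots> < \<epsilon> / 2"
      by (intro k) simp
    also have "d ((f ^^ (e + p k)) x) y < \<epsilon> / 2"
      unfolding e(1)[symmetric] by (intro k) simp
    finally have "d ((f ^^ e) y) y < \<epsilon>"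
      by simp
    with e(2) show ?thesis
      by blast
  qed
  with y show thesis by (rule that)
qed

text \<open>The distances \<open>d ((f ^^ (n + m)) y) ((f ^^ n) y)\<close> decrease in \<open>n\<close>, but recurrence brings them arbitrarily close to the
initial value again and again, so they are constant.\<close>

lemma recurrent_orbit_isometric:
  assumes y: "y \<in> M" and rec: "\<And>N \<epsilon>. \<epsilon> > 0 \<Longrightarrow> \<exists>m\<ge>N. d ((f ^^ m) y) y < \<epsilon>"
  shows "d ((f ^^ (n + m)) y) ((f ^^ n) y) = d ((f ^^ m) y) y"
proof (rule antisym)
  show "d ((f ^^ (n + m)) y) ((f ^^ n) y) \<le> d ((f ^^ m) y) y"
    using iterate_nonexpansive_add[OF y y, of n m 0] by simp
  show "d ((f ^^ m) y) y \<le> d ((f ^^ (n + m)) y) ((f ^^ n) y)"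
  proof (rule field_le_epsilon)
    fix \<epsilon> :: real assume "\<epsilon> > 0"
    then obtain k where k: "k \<ge> n" "d ((f ^^ k) y) y < \<epsilon> / 2"
      using rec[of "\<epsilon> / 2" n] by auto
    have "d ((f ^^ m) y) y \<le> d ((f ^^ m) y) ((f ^^ (m + k)) y) + d ((f ^^ (m + k)) y) y"
      by (intro triangle iterate_in y)
    also have "d ((f ^^ m) y) ((f ^^ (m + k)) y) \<le> d y ((f ^^ k) y)"
      using iterate_nonexpansive_add[OF y y, of m 0 k] by simp
    also have "d ((f ^^ (m + k)) y) y \<le> d ((f ^^ (m + k)) y) ((f ^^ k) y) + d ((f ^^ k) y) y"
      by (intro triangle iterate_in y)
    also have "d ((f ^^ (m + k)) y) ((f ^^ k) y) \<le> d ((f ^^ (n + m)) y) ((f ^^ n) y)"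
      using iterate_nonexpansive_add[OF y y, of "k - n" "n + m" n] k(1) by (simp add: add.commute)
    finally show "d ((f ^^ m) y) y \<le> d ((f ^^ (n + m)) y) ((f ^^ n) y) + \<epsilon>"
      using k(2) by (simp add: commute)
  qed
qed

text \<open>The radius \<open>2\<close> leaves room for the sum of two returns to the unit ball about \<open>y\<close>.\<close>

lemma finite_net_of_returns:
  assumes y: "y \<in> M"
  obtains J where "finite J"
    "\<And>n. \<lbrakk>0 < n; d ((f ^^ n) y) y < 2\<rbrakk> \<Longrightarrow> \<exists>j\<in>J. d ((f ^^ n) y) ((f ^^ j) y) < 1"
proof -
  define S where "S = {(f ^^ n) y | n. 0 < n \<and> d ((f ^^ n) y) y < 2}"
  have "mtotally_bounded S"
    unfolding mtotally_bounded_sequentially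
  proof (intro conjI allI impI)
    show "S \<subseteq> M"
      using iterate_in[OF y] by (auto simp: S_def)
    fix \<sigma> :: "nat \<Rightarrow> 'a" assume "range \<sigma> \<subseteq> S"
    then have \<sigma>: "\<sigma> n \<in> S" for n
      by blast
    have *: "v \<in> f ` M \<and> d v y \<le> 2" if "v \<in> S" for v
      using that iterate_in_image[OF y] by (auto simp: S_def)
    obtain l r where l: "l \<in> M" and r: "strict_mono (r :: nat \<Rightarrow> nat)" and lim: "(\<lambda>n. d (\<sigma> (r n)) l) \<longlonglongrightarrow> 0"
      using bounded_image_convergent_subseq[of \<sigma> y 2] *[OF \<sigma>] y by blast
    have "limitin mtopology (\<sigma> \<circ> r) l sequentially"
      using l lim subsetD[OF \<open>S \<subseteq> M\<close> \<sigma>] by (simp add: limitin_metric_dist_null o_def)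
    then have "MCauchy (\<sigma> \<circ> r)"
      using subsetD[OF \<open>S \<subseteq> M\<close> \<sigma>] by (intro convergent_imp_MCauchy) auto
    with r show "\<exists>r::nat \<Rightarrow> nat. strict_mono r \<and> MCauchy (\<sigma> \<circ> r)"
      by blast
  qed
  then obtain K where K: "finite K" "K \<subseteq> S" "S \<subseteq> (\<Union>x\<in>K. mball x 1)"
    unfolding mtotally_bounded_def by (meson zero_less_one)
  have "\<forall>v\<in>K. \<exists>n. v = (f ^^ n) y"
    using K(2) by (auto simp: S_def)
  then obtain t where t: "\<And>v. v \<in> K \<Longrightarrow> v = (f ^^ t v) y"
    by metis
  have "\<exists>j\<in>t ` K. d ((f ^^ n) y) ((f ^^ j) y) < 1" if "0 < n" "d ((f ^^ n) y) y < 2" for n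
  proof -
    have "(f ^^ n) y \<in> S"
      using that by (auto simp: S_def)
    then obtain v where "v \<in> K" "(f ^^ n) y \<in> mball v 1"
      using K(3) by blast
    then show ?thesis
      using t[of v] by (intro bexI[of _ "t v"]) (auto simp: commute)
  qed
  then show thesis
    using K(1) that[of "t ` K"] by blast
qed

text \<open>By recurrence and isometry, \<open>a m = d ((f ^^ m) y) y\<close> is also the distance between any two orbit points
that are \<open>m\<close> steps apart, so \<open>a\<close> is subadditive. Call \<open>n\<close> a return time if \<open>a n < 1\<close>, and fix a return time
\<open>P\<close> larger than all indices in the net for the ball of radius \<open>2\<close>. For a return time \<open>n\<close>, the point \<open>(f ^^ (n + P)) y\<close>
lies in this ball, hence within distance \<open>1\<close> of some \<open>(f ^^ j) y\<close> with \<open>j < P\<close>; then \<open>n + P - j\<close> is a return time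
as well. Thus return times have bounded gaps, and \<open>a\<close> is bounded.\<close>

theorem calka:
  assumes "x \<in> M" "w \<in> M" "\<not> filterlim (\<lambda>n. d ((f ^^ n) x) w) at_top sequentially"
  obtains y B where "y \<in> M" "\<And>n. d ((f ^^ n) y) y \<le> B"
proof -
  obtain y where y: "y \<in> M" and rec: "\<And>N \<epsilon>. \<epsilon> > 0 \<Longrightarrow> \<exists>m\<ge>N. d ((f ^^ m) y) y < \<epsilon>"
    using recurrent_point[OF assms] by metis
  define a where "a m = d ((f ^^ m) y) y" for m
  have iso: "d ((f ^^ (n + m)) y) ((f ^^ n) y) = a m" for m n
    unfolding a_def by (rule recurrent_orbit_isometric[OF y rec])
  have sub: "a (m + n) \<le> a m + a n" for m n
    using triangle[OF iterate_in[OF y, of "m + n"] iterate_in[OF y, of m] y] iso[of m n]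
    by (simp add: a_def)
  obtain J where J: "finite J"
    "\<And>n. \<lbrakk>0 < n; d ((f ^^ n) y) y < 2\<rbrakk> \<Longrightarrow> \<exists>j\<in>J. d ((f ^^ n) y) ((f ^^ j) y) < 1"
    using finite_net_of_returns[OF y] by metis
  obtain N where N: "\<forall>j\<in>J. j < N"
    using J(1) unfolding finite_nat_set_iff_bounded ..
  obtain P where P: "P \<ge> Suc N" "a P < 1"
    using rec[of 1 "Suc N"] by (auto simp: a_def)
  have gap: "\<exists>n'. n < n' \<and> n' \<le> n + P \<and> a n' < 1" if "a n < 1" for n
  proof -
    have "a (n + P) < 2"
      using sub[of n P] that P(2) by linarith
    then obtain j where j: "j \<in> J" "d ((f ^^ (n + P)) y) ((f ^^ j) y) < 1"
      using J(2)[of "n + P"] P(1) by (auto simp: a_def)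
    have "j < N"
      using N j by blast
    then have "a (n + P - j) < 1"
      using iso[of j "n + P - j"] j(2) P(1) by simp
    then show ?thesis
      using \<open>j < N\<close> P(1) by (intro exI[of _ "n + P - j"]) auto
  qed
  have return: "\<exists>n. a n < 1 \<and> n \<le> m \<and> m < n + P" for m
  proof (induction m)
    case 0
    have "a 0 = 0"
      using y by (simp add: a_def)
    then show ?case
      using P(1) by auto
  next
    case (Suc m)
    then obtain n where n: "a n < 1" "n \<le> m" "m < n + P"
      by blast
    show ?case
    proof (cases "Suc m < n + P")
      case True
      then show ?thesis
        using n by auto
    next
      case False
      with n have "Suc m = n + P"
        by simp
      moreover obtain n' where "n < n'" "n' \<le> n + P" "a n' < 1"
        using gap[OF n(1)] by blast
      ultimately show ?thesis
        by (intro exI[of _ n']) auto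
    qed
  qed
  have "a m \<le> 1 + (\<Sum>i<P. a i)" for m
  proof -
    obtain n where n: "a n < 1" "n \<le> m" "m < n + P"
      using return by blast
    have "a (m - n) \<le> (\<Sum>i<P. a i)"
      using n by (intro member_le_sum) (auto simp: a_def)
    then show ?thesis
      using sub[of n "m - n"] n by simp
  qed
  with y show thesis
    unfolding a_def by (rule that)
qed

end

section \<open>Bounded orbits and fixed points\<close>

lemma strictly_convex_set_imp_convex:
  assumes "strictly_convex_set D"
  shows "convex D"
proof -
  have "closed_segment x y \<subseteq> D" if "x \<in> D" "y \<in> D" for x y
  proof (cases "x = y")
    case False
    then have "open_segment x y \<subseteq> D"
      using assms that closure_subset unfolding strictly_convex_set_def by blast
    then show ?thesis
      using that by (auto simp: closed_segment_eq_open)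
  qed (use that in simp)
  then show ?thesis
    by (simp add: convex_contains_segment)
qed

locale compact_nonexpansive_map = Metric_space D d for D :: "'a::real_normed_vector set" and d +
  fixes f :: "'a \<Rightarrow> 'a"
  assumes strictly_convex: "strictly_convex_set D"
    and mtopology_eq: "mtopology = top_of_set D"
    and boundary_at_infinity:
      "\<lbrakk>w \<in> D; range s \<subseteq> D; l \<in> closure D - D; s \<longlonglongrightarrow> l\<rbrakk> \<Longrightarrow>
        filterlim (\<lambda>n::nat. d (s n) w) at_top sequentially"
    and balls_convex: "\<lbrakk>x \<in> D; y \<in> D; z \<in> D; 0 \<le> t; t \<le> 1\<rbrakk> \<Longrightarrow>
        d (t *\<^sub>R x + (1 - t) *\<^sub>R y) z \<le> max (d x z) (d y z)"
    and self_map: "f \<in> D \<rightarrow> D"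
    and compact_image: "compact (closure (f ` D))"
    and nonexpansive_map: "nonexpansive_on D d f"
begin

lemma convex_D: "convex D"
  by (rule strictly_convex_set_imp_convex[OF strictly_convex])

lemma convergence_iff:
  assumes "\<And>n. s n \<in> D" "l \<in> D"
  shows "s \<longlonglongrightarrow> l \<longleftrightarrow> (\<lambda>n. d (s n) l) \<longlonglongrightarrow> 0"
proof -
  have "limitin mtopology s l sequentially \<longleftrightarrow> s \<longlonglongrightarrow> l"
    unfolding mtopology_eq limitin_subtopology using assms by simp
  moreover have "limitin mtopology s l sequentially \<longleftrightarrow> (\<lambda>n. d (s n) l) \<longlonglongrightarrow> 0"
    unfolding limitin_metric_dist_null using assms by simp
  ultimately show ?thesis by simp
qed

lemma continuous_on_f: "continuous_on D f"
  unfolding continuous_on_sequentially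
proof (intro allI ballI impI, elim conjE)
  fix x a assume a: "a \<in> D" and "\<forall>n. x n \<in> D" and lim: "x \<longlonglongrightarrow> a"
  then have x: "x n \<in> D" for n
    by blast
  have "(\<lambda>n. d (x n) a) \<longlonglongrightarrow> 0"
    using lim a x by (simp add: convergence_iff)
  then have "(\<lambda>n. d (f (x n)) (f a)) \<longlonglongrightarrow> 0"
    by (rule tendsto_sandwich[OF _ _ tendsto_const, rotated 2])
      (use nonexpansive_map a x in \<open>auto simp: nonexpansive_on_def\<close>)
  then show "(f \<circ> x) \<longlonglongrightarrow> f a"
    using self_map a x by (subst convergence_iff) (auto simp: o_def)
qed

lemma bounded_limit_in_domain:
  assumes "\<And>n. s n \<in> D" "s \<longlonglongrightarrow> l" "w \<in> D" "\<And>n. d (s n) w \<le> R"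
  shows "l \<in> D"
proof (rule ccontr)
  assume "l \<notin> D"
  then have "l \<in> closure D - D"
    using assms closure_sequential by blast
  then have "filterlim (\<lambda>n. d (s n) w) at_top sequentially"
    using assms by (intro boundary_at_infinity) auto
  then have "\<forall>\<^sub>F n in sequentially. R < d (s n) w"
    by (simp add: filterlim_at_top_dense)
  then have "\<forall>\<^sub>F n::nat in sequentially. False"
  proof eventually_elim
    case (elim n)
    then show ?case
      using assms(4)[of n] by simp
  qed
  then show False
    by simp
qed

lemma divergent_limit_in_boundary:
  assumes "\<And>n. s n \<in> D" "s \<longlonglongrightarrow> l" "w \<in> D" "filterlim (\<lambda>n. d (s n) w) at_top sequentially"
  shows "l \<in> closure D - D"
proof -
  have False if l: "l \<in> D"
  proof -
    have lim: "(\<lambda>n. d (s n) l) \<longlonglongrightarrow> 0"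
      using assms l by (simp add: convergence_iff)
    have "\<forall>\<^sub>F n in sequentially. 1 + d l w \<le> d (s n) w"
      using assms(4) by (simp add: filterlim_at_top)
    moreover have "\<forall>\<^sub>F n in sequentially. d (s n) l < 1"
      using order_tendstoD(2)[OF lim zero_less_one] .
    ultimately have "\<forall>\<^sub>F n::nat in sequentially. False"
    proof eventually_elim
      case (elim n)
      then show ?case
        using triangle[OF assms(1)[of n] l assms(3)] by simp
    qed
    then show False
      by simp
  qed
  moreover have "l \<in> closure D"
    using assms closure_sequential by blast
  ultimately show ?thesis
    by blast
qed

lemma image_convergent_subseq:
  assumes "\<And>n. s n \<in> f ` D"
  obtains l r where "strict_mono (r :: nat \<Rightarrow> nat)" "(\<lambda>n. s (r n)) \<longlonglongrightarrow> l"
proof -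
  have "\<forall>n. s n \<in> closure (f ` D)"
    using assms closure_subset by blast
  then obtain l r where "l \<in> closure (f ` D)" "strict_mono (r :: nat \<Rightarrow> nat)" "(s \<circ> r) \<longlonglongrightarrow> l"
    using seq_compactE[OF compact_imp_seq_compact[OF compact_image]] by blast
  then show thesis
    using that[of r l] by (simp add: o_def)
qed

sublocale proper_nonexpansive_map D d f
proof unfold_locales
  show "f x \<in> D" if "x \<in> D" for x
    using self_map that by blast
  then have image: "y \<in> D" if "y \<in> f ` D" for y
    using that by blast
  show "d (f x) (f y) \<le> d x y" if "x \<in> D" "y \<in> D" for x y
    using nonexpansive_map that by (simp add: nonexpansive_on_def)
  fix s w R assume s: "\<And>n::nat. s n \<in> f ` D" and w: "w \<in> D" and R: "\<And>n. d (s n) w \<le> R"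
  obtain l r where l: "strict_mono (r :: nat \<Rightarrow> nat)" "(\<lambda>n. s (r n)) \<longlonglongrightarrow> l"
    by (rule image_convergent_subseq[OF s])
  have "l \<in> D"
    by (rule bounded_limit_in_domain[OF image[OF s] l(2) w R])
  moreover have "(\<lambda>n. d (s (r n)) l) \<longlonglongrightarrow> 0"
    using l(2) convergence_iff[of "\<lambda>n. s (r n)" l] image[OF s] \<open>l \<in> D\<close> by simp
  ultimately show "\<exists>l\<in>D. \<exists>r. strict_mono r \<and> (\<lambda>n. d (s (r n)) l) \<longlonglongrightarrow> 0"
    using l(1) by blast
qed

text \<open>\<open>C\<close> is the sublevel set \<open>limsup d z ((f ^^ n) y) \<le> B\<close>, phrased with an \<open>\<epsilon>\<close>. The limes superior
makes \<open>C\<close> invariant under \<open>f\<close>, because shifting the orbit does not change it, and it inherits convexity of sublevel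
sets from \<open>balls_convex\<close>. Since \<open>C\<close> is bounded, norm limits of its points remain in \<open>D\<close>, so the
compact closure of \<open>f ` C\<close> lies in \<open>C\<close>.\<close>

lemma bounded_orbit_imp_fixed_point:
  assumes y: "y \<in> D" and B: "\<And>n. d ((f ^^ n) y) y \<le> B"
  obtains x where "x \<in> D" "f x = x"
proof -
  define C where "C = {z \<in> D. \<forall>\<epsilon>>0. \<forall>\<^sub>F n in sequentially. d z ((f ^^ n) y) \<le> B + \<epsilon>}"
  have yC: "y \<in> C"
  proof -
    have "d y ((f ^^ n) y) \<le> B + \<epsilon>" if "\<epsilon> > 0" for n \<epsilon>
      using B[of n] that by (simp add: commute)
    then show ?thesis
      using y by (simp add: C_def)
  qed
  have "convex C"
    unfolding convex_alt
  proof (intro ballI allI impI, elim conjE)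
    fix u v and t :: real assume u: "u \<in> C" and v: "v \<in> C" and t: "0 \<le> t" "t \<le> 1"
    have D: "u \<in> D" "v \<in> D"
      using u v by (auto simp: C_def)
    have "(1 - t) *\<^sub>R u + t *\<^sub>R v \<in> D"
      using convex_D D t by (simp add: convex_alt)
    moreover have "\<forall>\<^sub>F n in sequentially. d ((1 - t) *\<^sub>R u + t *\<^sub>R v) ((f ^^ n) y) \<le> B + \<epsilon>"
      if "\<epsilon> > 0" for \<epsilon>
    proof -
      have "\<forall>\<^sub>F n in sequentially. d u ((f ^^ n) y) \<le> B + \<epsilon>"
        "\<forall>\<^sub>F n in sequentially. d v ((f ^^ n) y) \<le> B + \<epsilon>"
        using u v that by (auto simp: C_def)
      then show ?thesis
      proof eventually_elim
        case (elim n)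
        then show ?case
          using balls_convex[OF D(2,1) iterate_in[OF y, of n] t] by (simp add: add.commute)
      qed
    qed
    ultimately show "(1 - t) *\<^sub>R u + t *\<^sub>R v \<in> C"
      by (simp add: C_def)
  qed
  have fC: "f z \<in> C" if z: "z \<in> C" for z
  proof -
    have zD: "z \<in> D"
      using z by (simp add: C_def)
    have "\<forall>\<^sub>F n in sequentially. d (f z) ((f ^^ n) y) \<le> B + \<epsilon>" if "\<epsilon> > 0" for \<epsilon>
    proof -
      have "\<forall>\<^sub>F n in sequentially. d z ((f ^^ n) y) \<le> B + \<epsilon>"
        using z that by (simp add: C_def)
      then have "\<forall>\<^sub>F n in sequentially. d (f z) ((f ^^ Suc n) y) \<le> B + \<epsilon>"
      proof eventually_elim
        case (elim n)
        then show ?case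
          using nonexpansive[OF zD iterate_in[OF y, of n]] by simp
      qed
      then show ?thesis
        by (rule eventually_sequentially_Suc[THEN iffD1])
    qed
    then show ?thesis
      using maps[OF zD] by (simp add: C_def)
  qed
  have bound: "d z y \<le> 2 * B + 1" if z: "z \<in> C" for z
  proof -
    have "\<forall>\<^sub>F n in sequentially. d z ((f ^^ n) y) \<le> B + 1"
      using z by (simp add: C_def)
    then obtain n where n: "d z ((f ^^ n) y) \<le> B + 1"
      using eventually_happens sequentially_bot by blast
    have "z \<in> D"
      using z by (simp add: C_def)
    from triangle[OF this iterate_in[OF y, of n] y] n B[of n] show ?thesis
      by simp
  qed
  have closed: "l \<in> C" if s: "\<And>n. s n \<in> C" and lim: "s \<longlonglongrightarrow> l" for s l
  proof -
    have sD: "s n \<in> D" for n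
      using s by (simp add: C_def)
    have lD: "l \<in> D"
      by (rule bounded_limit_in_domain[OF sD lim y bound[OF s]])
    then have lim0: "(\<lambda>n. d (s n) l) \<longlonglongrightarrow> 0"
      using lim sD by (simp add: convergence_iff)
    have "\<forall>\<^sub>F n in sequentially. d l ((f ^^ n) y) \<le> B + \<epsilon>" if "\<epsilon> > 0" for \<epsilon>
    proof -
      have "\<forall>\<^sub>F k in sequentially. d (s k) l < \<epsilon> / 2"
        using that by (intro order_tendstoD(2)[OF lim0]) simp
      then obtain k where k: "d (s k) l < \<epsilon> / 2"
        using eventually_happens sequentially_bot by blast
      have "\<forall>\<^sub>F n in sequentially. d (s k) ((f ^^ n) y) \<le> B + \<epsilon> / 2"
        using s[of k] that by (simp add: C_def)
      then show ?thesis
      proof eventually_elim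
        case (elim n)
        then show ?case
          using triangle[OF lD sD[of k] iterate_in[OF y, of n]] k by (simp add: commute)
      qed
    qed
    with lD show ?thesis
      by (simp add: C_def)
  qed
  have CD: "C \<subseteq> D"
    by (auto simp: C_def)
  define Y where "Y = closure (f ` C)"
  have "Y \<subseteq> closure (f ` D)"
    unfolding Y_def by (intro closure_mono image_mono CD)
  then have "compact Y"
    using compact_image compact_Int_closed[of "closure (f ` D)" Y] by (simp add: Y_def Int_absorb1)
  moreover have "Y \<subseteq> C"
  proof
    fix l assume "l \<in> Y"
    then obtain s where s: "\<forall>n. s n \<in> f ` C" and lim: "s \<longlonglongrightarrow> l"
      unfolding Y_def closure_sequential by blast
    have "s n \<in> C" for n
      using spec[OF s, of n] fC by auto
    then show "l \<in> C"
      using lim by (rule closed)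
  qed
  moreover have "f ` C \<subseteq> Y"
    by (simp add: Y_def closure_subset)
  ultimately obtain x where "x \<in> C" "f x = x"
    using schauder_fixed_point[OF \<open>convex C\<close> _ continuous_on_subset[OF continuous_on_f CD]] yC
    by blast
  with CD show thesis
    using that by blast
qed

section \<open>Sequences with different limits\<close>

text \<open>The midpoints \<open>m n\<close> of \<open>u n\<close> and \<open>v n\<close> converge to a point \<open>p\<close> of \<open>D\<close> by strict convexity. The ball about \<open>u n\<close>
that contains \<open>v n\<close> also contains \<open>m n\<close>, so \<open>v n\<close> is at least as far from \<open>u n\<close> as \<open>m n\<close>, and hence up to a
constant as far as \<open>p\<close> or \<open>w\<close>.\<close>

lemma distance_to_other_limit:
  assumes u: "\<And>n. u n \<in> D" "u \<longlonglongrightarrow> \<xi>" and v: "\<And>n. v n \<in> D" "v \<longlonglongrightarrow> \<eta>"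
    and "\<xi> \<noteq> \<eta>" "w \<in> D"
  obtains C where "\<forall>\<^sub>F n in sequentially. d (u n) w - C \<le> d (u n) (v n)"
proof -
  define p where "p = (1/2) *\<^sub>R \<xi> + (1 - 1/2) *\<^sub>R \<eta>"
  define m where "m n = (1/2) *\<^sub>R u n + (1 - 1/2) *\<^sub>R v n" for n
  have "\<xi> \<in> closure D" "\<eta> \<in> closure D"
    using u v closure_sequential by blast+
  moreover have "p \<in> open_segment \<xi> \<eta>"
    using \<open>\<xi> \<noteq> \<eta>\<close> unfolding in_segment p_def by (auto intro!: exI[of _ "1/2"])
  ultimately have p: "p \<in> D"
    using strictly_convex \<open>\<xi> \<noteq> \<eta>\<close> unfolding strictly_convex_set_def by blast
  have m: "m n \<in> D" for n
    using convexD[OF convex_D u(1)[of n] v(1)[of n], of "1/2" "1/2"] by (simp add: m_def)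
  have "m \<longlonglongrightarrow> p"
    unfolding m_def p_def by (intro tendsto_intros u v)
  then have "(\<lambda>n. d (m n) p) \<longlonglongrightarrow> 0"
    using m p by (simp add: convergence_iff)
  from order_tendstoD(2)[OF this zero_less_one]
  have "\<forall>\<^sub>F n in sequentially. d (u n) w - (1 + d p w) \<le> d (u n) (v n)"
  proof eventually_elim
    case (elim n)
    have "d (m n) (u n) \<le> max (d (u n) (u n)) (d (v n) (u n))"
      unfolding m_def by (intro balls_convex u v) auto
    also have "\<dots> = d (u n) (v n)"
      using u v by (simp add: commute)
    finally show ?case
      using elim triangle[OF u(1)[of n] m[of n] \<open>w \<in> D\<close>] triangle[OF m[of n] p \<open>w \<in> D\<close>]
      by (simp add: commute)
  qed
  then show thesis
    by (rule that)
qed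

lemma bounded_distance_same_limit:
  assumes u: "\<And>n. u n \<in> D" "u \<longlonglongrightarrow> \<xi>" and v: "\<And>n. v n \<in> D" "v \<longlonglongrightarrow> \<eta>"
    and bounded: "\<And>n. d (u n) (v n) \<le> R"
    and w: "w \<in> D" and diverges: "filterlim (\<lambda>n. d (u n) w) at_top sequentially"
  shows "\<xi> = \<eta>"
proof (rule ccontr)
  assume "\<xi> \<noteq> \<eta>"
  obtain C where C: "\<forall>\<^sub>F n in sequentially. d (u n) w - C \<le> d (u n) (v n)"
    using distance_to_other_limit[OF u v \<open>\<xi> \<noteq> \<eta>\<close> w] by metis
  have "\<forall>\<^sub>F n in sequentially. R + C + 1 \<le> d (u n) w"
    using diverges by (simp add: filterlim_at_top)
  with C have "\<forall>\<^sub>F n::nat in sequentially. False"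
  proof eventually_elim
    case (elim n)
    then show ?case
      using bounded[of n] by simp
  qed
  then show False
    by simp
qed

end

section \<open>The limit of a divergent orbit\<close>

lemma record_times:
  fixes a :: "nat \<Rightarrow> real"
  assumes "filterlim a at_top sequentially"
  obtains n where "N < n" "\<And>m. m \<le> n \<Longrightarrow> a m \<le> a n"
proof -
  define b where "b = Max (a ` {..N})"
  have b: "a m \<le> b" if "m \<le> N" for m
    unfolding b_def using that by (intro Max_ge) auto
  have "\<forall>\<^sub>F n in sequentially. b < a n"
    using assms by (simp add: filterlim_at_top_dense)
  then have "\<exists>n. b < a n"
    by (rule eventually_happens'[OF sequentially_bot])
  define n where "n = (LEAST n. b < a n)"
  have n: "b < a n"
    unfolding n_def by (rule LeastI_ex) fact
  have before: "a m \<le> b" if "m < n" for m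
    using not_less_Least[of m "\<lambda>n. b < a n"] that by (simp add: n_def)
  have "a m \<le> a n" if "m \<le> n" for m
    using before[of m] n that by (cases "m = n") auto
  moreover have "N < n"
    using b n by (meson not_le)
  ultimately show thesis
    using that by blast
qed

locale quasi_geodesic_nonexpansive_map = compact_nonexpansive_map D d f
  for D :: "'a::real_normed_vector set" and d and f +
  fixes \<kappa> :: real
  assumes quasi_geodesics: "one_quasi_geodesic_space D d \<kappa>"
begin

text \<open>The curve is \<open>f \<circ> \<gamma>\<close> for a quasi-geodesic \<open>\<gamma>\<close> from \<open>x\<close> to \<open>y\<close>. Unlike \<open>\<gamma>\<close>, it stays in the
relatively compact set \<open>f ` D\<close>. It is still short, as \<open>f\<close> is nonexpansive: each of the three estimates
\<open>d x (\<gamma> t) \<le> t - a + \<kappa>\<close>, \<open>d y (\<gamma> t) \<le> b - t + \<kappa>\<close> and \<open>b - a \<le> d x y + \<kappa>\<close> contributes one \<open>\<kappa>\<close>.\<close>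

lemma image_of_quasi_geodesic_crosses_sphere:
  assumes xy: "x \<in> D" "y \<in> D" and r: "dist (f x) \<xi> \<le> \<rho>" "\<rho> \<le> dist (f y) \<xi>"
  obtains z where "z \<in> f ` D" "dist z \<xi> = \<rho>" "d (f x) z + d (f y) z \<le> d x y + 3 * \<kappa>"
proof -
  obtain a b \<gamma> where qg: "one_quasi_geodesic D d \<kappa> a b \<gamma>" and ends: "\<gamma> a = x" "\<gamma> b = y"
    using quasi_geodesics xy unfolding one_quasi_geodesic_space_def by blast
  have ab: "a \<le> b" and cont: "continuous_map (top_of_set {a..b}) (top_of_set D) \<gamma>"
    and est: "\<And>s t. \<lbrakk>s \<in> {a..b}; t \<in> {a..b}\<rbrakk> \<Longrightarrow>
      \<bar>s - t\<bar> - \<kappa> \<le> d (\<gamma> s) (\<gamma> t) \<and> d (\<gamma> s) (\<gamma> t) \<le> \<bar>s - t\<bar> + \<kappa>"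
    using qg unfolding one_quasi_geodesic_def mtopology_eq by auto
  have \<gamma>D: "\<gamma> ` {a..b} \<subseteq> D" and "continuous_on {a..b} \<gamma>"
    using cont by (auto simp: continuous_map_in_subtopology)
  then have "continuous_on {a..b} (\<lambda>t. f (\<gamma> t))"
    using continuous_on_compose2[OF continuous_on_f] by blast
  then have "continuous_on {a..b} (\<lambda>t. dist (f (\<gamma> t)) \<xi>)"
    by (intro continuous_intros)
  then obtain t where t: "a \<le> t" "t \<le> b" "dist (f (\<gamma> t)) \<xi> = \<rho>"
    using IVT'[of "\<lambda>t. dist (f (\<gamma> t)) \<xi>" a \<rho> b] r ab ends by auto
  have "\<gamma> t \<in> D"
    using \<gamma>D t by auto
  then have "d (f x) (f (\<gamma> t)) \<le> d x (\<gamma> t)" "d (f y) (f (\<gamma> t)) \<le> d y (\<gamma> t)"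
    using nonexpansive xy by auto
  moreover have "d x (\<gamma> t) \<le> t - a + \<kappa>" "d y (\<gamma> t) \<le> b - t + \<kappa>" "b - a - \<kappa> \<le> d x y"
    using est[of a t] est[of b t] est[of a b] t ab ends by auto
  ultimately show thesis
    using that[of "f (\<gamma> t)"] \<open>\<gamma> t \<in> D\<close> t(3) by auto
qed

text \<open>On a curve between \<open>f (x n)\<close> and \<open>f (y n)\<close> lies a point \<open>z n\<close> at half the distance of \<open>\<xi>\<close> and \<open>\<eta>\<close> from
\<open>\<xi>\<close>, and a limit \<open>\<zeta>\<close> of these points differs from both \<open>\<xi>\<close> and \<open>\<eta>\<close>. Applying the estimate
\<open>distance_to_other_limit\<close> to both halves of the curve shows that \<open>d (x n) (y n)\<close> is at least
\<open>d (f (x n)) w + d (f (y n)) w\<close>, up to a constant. The last assumption bounds it by the first summand alone,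
although the second one tends to infinity.\<close>

lemma no_two_limits:
  assumes xy: "\<And>n. x n \<in> D" "\<And>n. y n \<in> D"
    and lim: "(\<lambda>n. f (x n)) \<longlonglongrightarrow> \<xi>" "(\<lambda>n. f (y n)) \<longlonglongrightarrow> \<eta>"
    and w: "w \<in> D" and diverges: "filterlim (\<lambda>n. d (f (y n)) w) at_top sequentially"
    and close: "\<And>n. d (x n) (y n) \<le> d (f (x n)) w"
  shows "\<xi> = \<eta>"
proof (rule ccontr)
  assume ne: "\<xi> \<noteq> \<eta>"
  define \<rho> where "\<rho> = dist \<xi> \<eta> / 2"
  have \<rho>: "0 < \<rho>" "\<rho> < dist \<eta> \<xi>"
    using ne by (auto simp: \<rho>_def dist_commute)
  have "\<forall>\<^sub>F n in sequentially. dist (f (x n)) \<xi> < \<rho>"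
    using tendstoD[OF lim(1) \<rho>(1)] .
  moreover have "\<forall>\<^sub>F n in sequentially. \<rho> < dist (f (y n)) \<xi>"
    using order_tendstoD(1)[OF tendsto_dist[OF lim(2) tendsto_const] \<rho>(2)] .
  ultimately have "\<forall>\<^sub>F n in sequentially. dist (f (x n)) \<xi> \<le> \<rho> \<and> \<rho> \<le> dist (f (y n)) \<xi>"
    by eventually_elim simp
  then obtain N where N: "\<And>n. n \<ge> N \<Longrightarrow> dist (f (x n)) \<xi> \<le> \<rho> \<and> \<rho> \<le> dist (f (y n)) \<xi>"
    unfolding eventually_sequentially by blast
  have "\<exists>z. z \<in> f ` D \<and> dist z \<xi> = \<rho> \<and>
      d (f (x (n + N))) z + d (f (y (n + N))) z \<le> d (x (n + N)) (y (n + N)) + 3 * \<kappa>" for n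
    using image_of_quasi_geodesic_crosses_sphere[OF xy(1,2)[of "n + N"], of \<xi> \<rho>] N[of "n + N"]
    by (metis le_add2)
  then obtain z where z: "\<And>n. z n \<in> f ` D" "\<And>n. dist (z n) \<xi> = \<rho>"
    and zd: "\<And>n. d (f (x (n + N))) (z n) + d (f (y (n + N))) (z n)
        \<le> d (x (n + N)) (y (n + N)) + 3 * \<kappa>"
    by metis
  obtain \<zeta> r where r: "strict_mono (r :: nat \<Rightarrow> nat)" and \<zeta>: "(\<lambda>n. z (r n)) \<longlonglongrightarrow> \<zeta>"
    by (rule image_convergent_subseq[OF z(1)])
  have "dist \<zeta> \<xi> = \<rho>"
    using LIMSEQ_unique[OF tendsto_dist[OF \<zeta> tendsto_const[of \<xi>]]] z(2) by simp
  then have \<zeta>_ne: "\<xi> \<noteq> \<zeta>" "\<eta> \<noteq> \<zeta>"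
    using \<rho> by auto
  define k where "k n = r n + N" for n
  have k: "filterlim k sequentially sequentially"
    using filterlim_subseq[of k] r by (simp add: k_def strict_mono_def)
  have fD: "f (x (k n)) \<in> D" "f (y (k n)) \<in> D" "z (r n) \<in> D" for n
    using maps xy z(1)[of "r n"] by auto
  obtain A where A: "\<forall>\<^sub>F n in sequentially. d (f (x (k n))) w - A \<le> d (f (x (k n))) (z (r n))"
    using distance_to_other_limit[OF fD(1) filterlim_compose[OF lim(1) k] fD(3) \<zeta> \<zeta>_ne(1) w] by metis
  obtain B where B: "\<forall>\<^sub>F n in sequentially. d (f (y (k n))) w - B \<le> d (f (y (k n))) (z (r n))"
    using distance_to_other_limit[OF fD(2) filterlim_compose[OF lim(2) k] fD(3) \<zeta> \<zeta>_ne(2) w] by metis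
  have "\<forall>\<^sub>F n in sequentially. A + B + 3 * \<kappa> + 1 \<le> d (f (y (k n))) w"
    using filterlim_compose[OF diverges k] by (simp add: filterlim_at_top)
  with A B have "\<forall>\<^sub>F n::nat in sequentially. False"
  proof eventually_elim
    case (elim n)
    then show ?case
      using zd[of "r n", folded k_def] close[of "k n"] by linarith
  qed
  then show False
    by simp
qed

text \<open>\<open>\<xi>\<close> is a limit of the orbit along record times \<open>\<sigma> N\<close> of the distance to \<open>x\<close>. If times \<open>k j\<close> led to another
limit \<open>\<eta>\<close>, then \<open>d ((f ^^ (m - 1)) x) ((f ^^ (k - 1)) x) \<le> a (m - k) \<le> a m\<close> with \<open>k = k j\<close> and the record
\<open>m = \<sigma> (k j) > k j\<close>, which is excluded by \<open>no_two_limits\<close>. The exponents are lowered by one because that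
lemma speaks about preimages of the two converging sequences.\<close>

lemma divergent_orbit_converges:
  assumes x: "x \<in> D" and diverges: "filterlim (\<lambda>n. d ((f ^^ n) x) x) at_top sequentially"
  obtains \<xi> where "\<xi> \<in> closure D - D" "(\<lambda>n. (f ^^ n) x) \<longlonglongrightarrow> \<xi>"
proof -
  define a where "a n = d ((f ^^ n) x) x" for n
  have "\<exists>n>N. \<forall>m\<le>n. a m \<le> a n" for N
    using record_times[of a N] diverges unfolding a_def by metis
  then obtain rec where rec: "\<And>N. N < rec N" "\<And>N m. m \<le> rec N \<Longrightarrow> a m \<le> a (rec N)"
    by metis
  have "(f ^^ rec N) x \<in> f ` D" for N
    using rec(1)[of N] by (intro iterate_in_image x) simp
  from this obtain \<xi> r where r: "strict_mono (r :: nat \<Rightarrow> nat)" and \<xi>: "(\<lambda>N. (f ^^ rec (r N)) x) \<longlonglongrightarrow> \<xi>"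
    by (rule image_convergent_subseq)
  define \<sigma> where "\<sigma> N = rec (r N)" for N
  have \<sigma>: "N < \<sigma> N" for N
    using rec(1)[of "r N"] seq_suble[OF r, of N] by (simp add: \<sigma>_def)
  have \<sigma>_max: "a m \<le> a (\<sigma> N)" if "m \<le> \<sigma> N" for m N
    using rec(2) that by (simp add: \<sigma>_def)
  have \<sigma>_lim: "(\<lambda>N. (f ^^ \<sigma> N) x) \<longlonglongrightarrow> \<xi>"
    using \<xi> by (simp add: \<sigma>_def)
  have "filterlim \<sigma> sequentially sequentially"
    by (rule filterlim_at_top_mono[OF filterlim_ident]) (use less_imp_le[OF \<sigma>] in simp)
  then have \<sigma>_div: "filterlim (\<lambda>N. d ((f ^^ \<sigma> N) x) x) at_top sequentially"
    by (rule filterlim_compose[OF diverges])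
  have \<xi>_boundary: "\<xi> \<in> closure D - D"
    by (rule divergent_limit_in_boundary[OF iterate_in[OF x] \<sigma>_lim x \<sigma>_div])

  have "(\<lambda>n. (f ^^ n) x) \<longlonglongrightarrow> \<xi>"
  proof (rule ccontr)
    assume "\<not> ?thesis"
    then obtain e where e: "e > 0" "\<not> (\<forall>\<^sub>F n in sequentially. dist ((f ^^ n) x) \<xi> < e)"
      unfolding tendsto_iff by blast
    then obtain q where q: "strict_mono (q :: nat \<Rightarrow> nat)" "\<And>j. e \<le> dist ((f ^^ q j) x) \<xi>"
      using not_eventually_sequentiallyD[OF e(2)] by (auto simp: not_less)
    have q_pos: "0 < q (Suc j)" for j
      using strict_monoD[OF q(1), of j "Suc j"] by simp
    obtain \<eta> s where s: "strict_mono (s :: nat \<Rightarrow> nat)" and \<eta>: "(\<lambda>j. (f ^^ q (Suc (s j))) x) \<longlonglongrightarrow> \<eta>"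
      by (rule image_convergent_subseq[OF iterate_in_image[OF x q_pos]])
    define k where "k j = q (Suc (s j))" for j
    have k_pos: "0 < k j" for j
      using q_pos by (simp add: k_def)
    have "strict_mono k"
      using q(1) s by (simp add: k_def strict_mono_def)
    then have k_lim: "filterlim k sequentially sequentially"
      by (rule filterlim_subseq)
    have \<eta>': "(\<lambda>j. (f ^^ k j) x) \<longlonglongrightarrow> \<eta>"
      using \<eta> by (simp add: k_def)
    have step: "f ((f ^^ (n - 1)) x) = (f ^^ n) x" if "0 < n" for n
      using that by (cases n) auto
    have \<sigma>k: "0 < \<sigma> (k j)" "k j < \<sigma> (k j)" for j
      using \<sigma>[of "k j"] by auto
    have "\<xi> = \<eta>"
    proof (rule no_two_limits[of "\<lambda>j. (f ^^ (\<sigma> (k j) - 1)) x" "\<lambda>j. (f ^^ (k j - 1)) x" _ _ x])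
      show "(f ^^ (\<sigma> (k j) - 1)) x \<in> D" "(f ^^ (k j - 1)) x \<in> D" for j
        by (intro iterate_in x)+
      show "(\<lambda>j. f ((f ^^ (\<sigma> (k j) - 1)) x)) \<longlonglongrightarrow> \<xi>"
        using filterlim_compose[OF \<sigma>_lim k_lim] by (simp only: step[OF \<sigma>k(1)])
      show "(\<lambda>j. f ((f ^^ (k j - 1)) x)) \<longlonglongrightarrow> \<eta>"
        using \<eta>' by (simp only: step[OF k_pos])
      show "filterlim (\<lambda>j. d (f ((f ^^ (k j - 1)) x)) x) at_top sequentially"
        using filterlim_compose[OF diverges k_lim] by (simp only: step[OF k_pos])
      fix j
      have "d ((f ^^ (\<sigma> (k j) - 1)) x) ((f ^^ (k j - 1)) x) \<le> a (\<sigma> (k j) - k j)"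
        using iterate_nonexpansive_add[OF x x, of "k j - 1" "\<sigma> (k j) - k j" 0] \<sigma>k[of j] k_pos[of j]
        by (simp add: a_def)
      also have "\<dots> \<le> a (\<sigma> (k j))"
        by (rule \<sigma>_max) simp
      finally show "d ((f ^^ (\<sigma> (k j) - 1)) x) ((f ^^ (k j - 1)) x)
          \<le> d (f ((f ^^ (\<sigma> (k j) - 1)) x)) x"
        by (simp only: step[OF \<sigma>k(1)] a_def)
    qed (rule x)
    then have "\<forall>\<^sub>F j in sequentially. dist ((f ^^ k j) x) \<xi> < e"
      using tendstoD[OF \<eta>' e(1)] by simp
    then obtain j where "dist ((f ^^ k j) x) \<xi> < e"
      using eventually_happens'[OF sequentially_bot] by blast
    then show False
      using q(2)[of "Suc (s j)"] by (simp add: k_def)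
  qed
  with \<xi>_boundary show thesis
    using that by blast
qed

text \<open>A failure of uniformity yields points \<open>y j\<close> of \<open>K\<close> and times \<open>q j\<close> such that \<open>(f ^^ q j) (y j)\<close> stays away from \<open>\<xi>\<close>.
This sequence remains at bounded \<open>d\<close>-distance from \<open>(f ^^ q j) x\<close>, so its limit points are \<open>\<xi>\<close> nevertheless.\<close>

lemma uniform_convergence:
  assumes x: "x \<in> D" and diverges: "filterlim (\<lambda>n. d ((f ^^ n) x) x) at_top sequentially"
    and lim: "(\<lambda>n. (f ^^ n) x) \<longlonglongrightarrow> \<xi>" and K: "mbounded K"
  shows "uniform_limit K (\<lambda>n. f ^^ n) (\<lambda>_. \<xi>) sequentially"
proof (rule ccontr)
  assume "\<not> ?thesis"
  then obtain e where e: "e > 0" "\<not> (\<forall>\<^sub>F n in sequentially. \<forall>y\<in>K. dist ((f ^^ n) y) \<xi> < e)"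
    unfolding uniform_limit_iff by blast
  then obtain q where q: "strict_mono (q :: nat \<Rightarrow> nat)" "\<And>j. \<exists>y\<in>K. e \<le> dist ((f ^^ q j) y) \<xi>"
    using not_eventually_sequentiallyD[OF e(2)] by (auto simp: not_less)
  then obtain y where y: "\<And>j. y j \<in> K" "\<And>j. e \<le> dist ((f ^^ q j) (y j)) \<xi>"
    by metis
  obtain c B where KB: "K \<subseteq> mcball c B" "c \<in> D"
    using K y(1) unfolding mbounded_def by fastforce
  have yD: "y j \<in> D" for j
    using KB y(1)[of j] by auto
  have yx: "d (y j) x \<le> B + d c x" for j
    using KB y(1)[of j] triangle[OF yD \<open>c \<in> D\<close> x, of j] by (auto simp: commute)
  have q_pos: "0 < q (Suc j)" for j
    using strict_monoD[OF q(1), of j "Suc j"] by simp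
  obtain \<eta> s where s: "strict_mono (s :: nat \<Rightarrow> nat)"
    and \<eta>: "(\<lambda>j. (f ^^ q (Suc (s j))) (y (Suc (s j)))) \<longlonglongrightarrow> \<eta>"
    by (rule image_convergent_subseq[OF iterate_in_image[OF yD q_pos]])
  define k where "k j = q (Suc (s j))" for j
  have "strict_mono k"
    using q(1) s by (simp add: k_def strict_mono_def)
  then have k_lim: "filterlim k sequentially sequentially"
    by (rule filterlim_subseq)
  have "\<xi> = \<eta>"
  proof (rule bounded_distance_same_limit[of "\<lambda>j. (f ^^ k j) x" _ "\<lambda>j. (f ^^ k j) (y (Suc (s j)))" _ "B + d c x" x])
    show "(\<lambda>j. (f ^^ k j) x) \<longlonglongrightarrow> \<xi>"
      by (rule filterlim_compose[OF lim k_lim])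
    show "(\<lambda>j. (f ^^ k j) (y (Suc (s j)))) \<longlonglongrightarrow> \<eta>"
      using \<eta> by (simp add: k_def)
    show "filterlim (\<lambda>j. d ((f ^^ k j) x) x) at_top sequentially"
      by (rule filterlim_compose[OF diverges k_lim])
    show "d ((f ^^ k j) x) ((f ^^ k j) (y (Suc (s j)))) \<le> B + d c x" for j
      using iterate_nonexpansive[OF x yD, of "k j" "Suc (s j)"] yx[of "Suc (s j)"] by (simp add: commute)
  qed (simp_all add: iterate_in x yD)
  then have "\<forall>\<^sub>F j in sequentially. dist ((f ^^ k j) (y (Suc (s j)))) \<xi> < e"
    using tendstoD[OF \<eta> e(1)] by (simp add: k_def)
  then obtain j where "dist ((f ^^ k j) (y (Suc (s j)))) \<xi> < e"
    using eventually_happens'[OF sequentially_bot] by blast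
  then show False
    using y(2)[of "Suc (s j)"] by (simp add: k_def)
qed

end

theorem theorem5p4:
  fixes D :: "'a::banach set"
    and d :: "'a \<Rightarrow> 'a \<Rightarrow> real"
    and \<kappa> :: real
    and f :: "'a \<Rightarrow> 'a"
  assumes "open D" and "connected D" and "D \<noteq> {}"
    and "strictly_convex_set D"
    and "\<kappa> \<ge> 0"
    and "Metric_space D d"
    and "one_quasi_geodesic_space D d \<kappa>"
    and "axiom1' D d"
    and "\<And>x y z s. \<lbrakk>x \<in> D; y \<in> D; z \<in> D; 0 \<le> s; s \<le> 1\<rbrakk> \<Longrightarrow>
           d (s *\<^sub>R x + (1 - s) *\<^sub>R y) z \<le> max (d x z) (d y z)"
    and "f \<in> D \<rightarrow> D"
    and "compact_mapping_on D f"
    and "nonexpansive_on D d f"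
    and "\<not> (\<exists>x\<in>D. f x = x)"
  shows "\<exists>\<xi>\<in>closure D - D. converges_uniformly_on_bounded D d (\<lambda>n. f ^^ n) \<xi>"
proof -
  interpret Metric_space D d
    by fact
  interpret quasi_geodesic_nonexpansive_map D d f \<kappa>
  proof unfold_locales
    show "mtopology = top_of_set D"
      using \<open>axiom1' D d\<close> by (simp add: axiom1'_def)
    show "filterlim (\<lambda>n. d (s n) w) at_top sequentially"
      if "w \<in> D" "range s \<subseteq> D" "l \<in> closure D - D" "s \<longlonglongrightarrow> l" for w l and s :: "nat \<Rightarrow> 'a"
      using \<open>axiom1' D d\<close> that unfolding axiom1'_def by blast
    show "compact (closure (f ` D))"
      using \<open>compact_mapping_on D f\<close> by (simp add: compact_mapping_on_def)
  qed fact+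
  obtain x where x: "x \<in> D"
    using \<open>D \<noteq> {}\<close> by blast
  have diverges: "filterlim (\<lambda>n. d ((f ^^ n) x) x) at_top sequentially"
  proof (rule ccontr)
    assume "\<not> ?thesis"
    then obtain y B where "y \<in> D" "\<And>n. d ((f ^^ n) y) y \<le> B"
      using calka[OF x x] by metis
    then show False
      using bounded_orbit_imp_fixed_point \<open>\<not> (\<exists>x\<in>D. f x = x)\<close> by metis
  qed
  obtain \<xi> where "\<xi> \<in> closure D - D" "(\<lambda>n. (f ^^ n) x) \<longlonglongrightarrow> \<xi>"
    using divergent_orbit_converges[OF x diverges] by metis
  then show ?thesis
    using uniform_convergence[OF x diverges] by (auto simp: converges_uniformly_on_bounded_def)
qed

end
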